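(* For any $3$-NU graph $H$ and any $d$-instance $(H,u,v,\phi,\psi)$ of the shortest path reconfiguration problem, there is a path between $\phi$ and $\psi$ in $\mathrm{SP}(H,u,v)$ of length at most $d^2/2-1$.
   Context: Graphs are undirected, may have loops, and have no multiple edges. A homomorphism is an edge-preserving vertex map. $H^3$ is the categorical product: triples are adjacent iff they are adjacent in every coordinate. $H$ is a $3$-NU graph if there is a homomorphism $f:H^3\to H$ with $f(x_1,x_2,x_3)=x$ whenever at least two of the $x_i$ are equal to $x$. $\mathrm{SP}(H,u,v)$ is the graph whose vertices are the shortest $uv$-paths in $H$, two being adjacent if they differ on a single vertex. An instance $(H,u,v,\phi,\psi)$ of the shortest path reconfiguration problem consists of a graph $H$, vertices $u,v$ of $H$, and shortest $uv$-paths $\phi,\psi$ in $H$; the problem asks whether there is a path between $\phi$ and $\psi$ in $\mathrm{SP}(H,u,v)$. It is a $d$-instance if the distance $d_H(u,v)$ between $u$ and $v$ in $H$ is $d$.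
   Formalization: For d = 0 and d = 1 the bound d²/2 − 1 is negative and no path can satisfy it; the formal statement bounds the length by max(0, d²/2 − 1), which is the stated bound for every d ≥ 2 and gives length 0 for d = 0, 1. *)

theory Defs
  imports "Graph_Theory.Graph_Theory" "HOL-Library.Extended_Nat"
begin

text \<open>
  A graph (undirected, loops allowed, no multiple edges, not necessarily finite) is a
  \<^locale>\<open>pair_sym_digraph\<close>: an edge between \<open>x\<close> and \<open>y\<close> is the pair of arcs
  \<open>(x, y)\<close>, \<open>(y, x)\<close>, and a loop at \<open>x\<close> is the arc \<open>(x, x)\<close>.
\<close>

definition graph_hom :: "('a \<Rightarrow> 'b) \<Rightarrow> 'a pair_pre_digraph \<Rightarrow> 'b pair_pre_digraph \<Rightarrow> bool" where
  "graph_hom f G H \<longleftrightarrow>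
     (\<forall>x \<in> pverts G. f x \<in> pverts H) \<and>
     (\<forall>x y. (x, y) \<in> parcs G \<longrightarrow> (f x, f y) \<in> parcs H)"

definition cube :: "'a pair_pre_digraph \<Rightarrow> ('a \<times> 'a \<times> 'a) pair_pre_digraph" where
  "cube H = \<lparr> pverts = pverts H \<times> pverts H \<times> pverts H,
     parcs = {((x1, x2, x3), (y1, y2, y3)) | x1 x2 x3 y1 y2 y3.
       (x1, y1) \<in> parcs H \<and> (x2, y2) \<in> parcs H \<and> (x3, y3) \<in> parcs H} \<rparr>"

definition nu3_graph :: "'a pair_pre_digraph \<Rightarrow> bool" where
  "nu3_graph H \<longleftrightarrow> pair_sym_digraph H \<and>
     (\<exists>f. graph_hom f (cube H) H \<and>
       (\<forall>x \<in> pverts H. \<forall>y \<in> pverts H.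
          f (x, x, y) = x \<and> f (x, y, x) = x \<and> f (y, x, x) = x))"

definition path_between :: "'a pair_pre_digraph \<Rightarrow> 'a \<Rightarrow> 'a \<Rightarrow> 'a vwalk \<Rightarrow> bool" where
  "path_between G u v p \<longleftrightarrow> vpath p (with_proj G) \<and> hd p = u \<and> last p = v"

text \<open>The distance is \<open>\<infinity>\<close> when there is no path.\<close>

definition graph_dist :: "'a pair_pre_digraph \<Rightarrow> 'a \<Rightarrow> 'a \<Rightarrow> enat" where
  "graph_dist G u v = (INF p \<in> {p. path_between G u v p}. enat (vwalk_length p))"

definition shortest_path :: "'a pair_pre_digraph \<Rightarrow> 'a \<Rightarrow> 'a \<Rightarrow> 'a vwalk \<Rightarrow> bool" where
  "shortest_path G u v p \<longleftrightarrow>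
     path_between G u v p \<and> enat (vwalk_length p) = graph_dist G u v"

text \<open>
  All shortest \<open>uv\<close>-paths are vertex lists of the same length, so two of them differ on a
  single vertex iff they disagree at exactly one position.
\<close>

definition SP :: "'a pair_pre_digraph \<Rightarrow> 'a \<Rightarrow> 'a \<Rightarrow> 'a vwalk pair_pre_digraph" where
  "SP H u v = \<lparr> pverts = {p. shortest_path H u v p},
     parcs = {(p, q). shortest_path H u v p \<and> shortest_path H u v q \<and>
       (\<exists>!i. i < length p \<and> p ! i \<noteq> q ! i)} \<rparr>"

definition spr_instance ::
    "'a pair_pre_digraph \<Rightarrow> 'a \<Rightarrow> 'a \<Rightarrow> 'a vwalk \<Rightarrow> 'a vwalk \<Rightarrow> bool" where
  "spr_instance H u v \<phi> \<psi> \<longleftrightarrow> pair_sym_digraph H \<and> u \<in> pverts H \<and> v \<in> pverts H \<and>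
     shortest_path H u v \<phi> \<and> shortest_path H u v \<psi>"

definition spr_d_instance ::
    "nat \<Rightarrow> 'a pair_pre_digraph \<Rightarrow> 'a \<Rightarrow> 'a \<Rightarrow> 'a vwalk \<Rightarrow> 'a vwalk \<Rightarrow> bool" where
  "spr_d_instance d H u v \<phi> \<psi> \<longleftrightarrow> spr_instance H u v \<phi> \<psi> \<and> graph_dist H u v = enat d"

lemma pair_sym_digraph_cube:
  assumes "pair_sym_digraph H" shows "pair_sym_digraph (cube H)"
proof -
  interpret pair_sym_digraph H by fact
  have s: "(y, x) \<in> parcs H" if "(x, y) \<in> parcs H" for x y
    using pair_sym_arcs that by (simp add: symmetric_def sym_def)
  show ?thesis
  proof
    show "symmetric (with_proj (cube H))"
      unfolding symmetric_def by (rule symI) (auto simp: cube_def intro: s)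
  qed (auto simp: cube_def dest: in_arcsD1 in_arcsD2)
qed

lemma shortest_path_length_eq:
  assumes "shortest_path H u v p" "shortest_path H u v q" shows "length p = length q"
proof -
  have "p \<noteq> []" "q \<noteq> []"
    using assms by (auto simp: shortest_path_def path_between_def vpath_def vwalk_def)
  moreover have "enat (vwalk_length p) = enat (vwalk_length q)"
    using assms unfolding shortest_path_def by metis
  ultimately show ?thesis
    by (cases p; cases q) auto
qed

lemma pair_bidirected_digraph_SP: "pair_bidirected_digraph (SP H u v)"
proof unfold_locales
  have "(q, p) \<in> parcs (SP H u v)" if "(p, q) \<in> parcs (SP H u v)" for p q
  proof -
    have "length p = length q"
      using that by (auto simp: SP_def intro: shortest_path_length_eq)
    then have "(\<lambda>i. i < length q \<and> q ! i \<noteq> p ! i) = (\<lambda>i. i < length p \<and> p ! i \<noteq> q ! i)"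
      by auto
    then show ?thesis
      using that unfolding SP_def by simp
  qed
  then show "symmetric (with_proj (SP H u v))"
    by (simp add: symmetric_def sym_def)
qed (auto simp: SP_def)

end

theory Submission
  imports Defs
begin

text \<open>
  Let \<open>f\<close> be a majority homomorphism. For every walk \<open>w\<close> of \<open>H\<close>, whatever its end vertices,
  \<open>f (\<phi> ! i, \<psi> ! i, w i)\<close> (\<open>i \<le> d\<close>) is again a walk of length \<open>d\<close> from \<open>u\<close> to \<open>v\<close>, hence a
  shortest path; \<open>w = \<phi>\<close> and \<open>w = \<psi>\<close> give back \<open>\<phi>\<close> and \<open>\<psi>\<close>. So it suffices to reconfigure
  \<open>\<phi>\<close> into \<open>\<psi>\<close> through walks with free end vertices, and only changes at the interior positions
  count. The walk \<open>\<phi>\<close> is folded step by step onto its first edge: \<open>\<phi>\<^sub>0\<dots>\<phi>\<^sub>t\<phi>\<^sub>t\<^sub>-\<^sub>1\<phi>\<^sub>t\<dots>\<close> turns into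
  \<open>\<phi>\<^sub>0\<dots>\<phi>\<^sub>t\<^sub>-\<^sub>1\<phi>\<^sub>t\<^sub>-\<^sub>2\<phi>\<^sub>t\<^sub>-\<^sub>1\<dots>\<close> by changing every second position from \<open>t\<close> on, which takes
  \<open>\<lfloor>(d - 1)\<^sup>2 / 4\<rfloor>\<close> steps in total. The same number of steps unfolds \<open>\<psi>\<close>, and \<open>\<lfloor>d / 2\<rfloor>\<close> steps replace
  the first edge of \<open>\<phi>\<close> by that of \<open>\<psi>\<close>.
\<close>

section \<open>Walks, shortest paths and step counts\<close>

lemma vwalk_conv_nth:
  "vwalk p G \<longleftrightarrow> p \<noteq> [] \<and> set p \<subseteq> verts G \<and>
     (\<forall>i. Suc i < length p \<longrightarrow> (p ! i, p ! Suc i) \<in> arcs_ends G)"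
proof -
  have "set (vwalk_arcs p) = {(p ! i, p ! Suc i) | i. Suc i < length p}"
  proof (induction p rule: vwalk_arcs.induct)
    case (3 x y xs)
    have "{((x # y # xs) ! i, (x # y # xs) ! Suc i) | i. Suc i < length (x # y # xs)} =
      insert (x, y) {((y # xs) ! i, (y # xs) ! Suc i) | i. Suc i < length (y # xs)}"
      (is "?L = ?R")
    proof
      show "?L \<subseteq> ?R"
      proof
        fix e assume "e \<in> ?L"
        then obtain i where i: "e = ((x # y # xs) ! i, (x # y # xs) ! Suc i)"
          "Suc i < length (x # y # xs)"
          by blast
        then show "e \<in> ?R"
          by (cases i) auto
      qed
      show "?R \<subseteq> ?L"
      proof
        fix e assume "e \<in> ?R"
        then consider "e = (x, y)"
          | i where "e = ((y # xs) ! i, (y # xs) ! Suc i)" "Suc i < length (y # xs)"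
          by blast
        then show "e \<in> ?L"
        proof cases
          case 1
          then show ?thesis
            by (auto intro!: exI[of _ 0])
        next
          case (2 i)
          then show ?thesis
            by (auto intro!: exI[of _ "Suc i"])
        qed
      qed
    qed
    with 3 show ?case
      by simp
  qed auto
  then show ?thesis
    unfolding vwalk_def by auto
qed

text \<open>Bounding by the number of distinct vertices makes \<open>q\<close> strictly shorter than
  \<open>p\<close> as soon as \<open>p\<close> repeats a vertex.\<close>

lemma vwalk_imp_shorter_vpath:
  assumes "vwalk p G"
  obtains q where "vpath q G" "hd q = hd p" "last q = last p" "length q \<le> card (set p)"
proof
  let ?q = "vwalk_to_vpath p"
  show q: "vpath ?q G"
    using assms by (rule vwalk_to_vpath_vpath)
  have "length ?q = card (set ?q)"
    using q by (simp add: vpath_def distinct_card)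
  also have "\<dots> \<le> card (set p)"
    by (intro card_mono) (auto dest: vwalk_to_vpath_subset)
  finally show "length ?q \<le> card (set p)" .
qed (simp_all add: vwalk_to_vpath_hd vwalk_to_vpath_last)

text \<open>A repeated vertex could be cut out, leaving a path shorter than the distance; so the
  right length already forces distinctness.\<close>

lemma vwalk_of_length_dist_imp_shortest_path:
  assumes "vwalk p (with_proj G)" "hd p = u" "last p = v"
    and "enat (vwalk_length p) = graph_dist G u v"
  shows "shortest_path G u v p"
proof -
  obtain q where q: "vpath q (with_proj G)" "hd q = u" "last q = v" "length q \<le> card (set p)"
    using vwalk_imp_shorter_vpath[OF assms(1)] assms(2,3) by metis
  have "q \<noteq> []" "p \<noteq> []"
    using q(1) assms(1) by auto
  have "graph_dist G u v \<le> enat (vwalk_length q)"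
    unfolding graph_dist_def using q by (auto simp: path_between_def intro: INF_lower)
  then have "length p \<le> length q"
    using assms(4)[symmetric] \<open>q \<noteq> []\<close> \<open>p \<noteq> []\<close> by (cases p; cases q) auto
  then have "distinct p"
    using q(4) card_length[of p] by (intro card_distinct) linarith
  then show ?thesis
    using assms by (auto simp: shortest_path_def path_between_def)
qed

text \<open>Idle steps are dropped and cycles cut out, so step counts given by relation powers bound
  path lengths.\<close>

lemma relpow_reflcl_imp_path_between:
  assumes "(p, q) \<in> ((parcs G)\<^sup>=) ^^ n" "q \<in> pverts G" "pair_wf_digraph G"
  shows "\<exists>P. path_between G p q P \<and> vwalk_length P \<le> n"
proof -
  interpret pair_wf_digraph G by fact
  have "\<exists>W. vwalk W (with_proj G) \<and> hd W = p \<and> last W = q \<and> length W \<le> Suc n"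
    using assms(1)
  proof (induction n arbitrary: p)
    case 0
    then show ?case
      using assms(2) by (intro exI[of _ "[q]"]) (auto simp: vwalk_def)
  next
    case (Suc n)
    obtain r where r: "(p, r) \<in> (parcs G)\<^sup>=" "(r, q) \<in> ((parcs G)\<^sup>=) ^^ n"
      using relpow_Suc_E2[OF Suc.prems] by blast
    obtain W where W: "vwalk W (with_proj G)" "hd W = r" "last W = q" "length W \<le> Suc n"
      using Suc.IH[OF r(2)] by blast
    show ?case
    proof (cases "p = r")
      case True
      with W show ?thesis
        by (intro exI[of _ W]) auto
    next
      case False
      with r have "(p, r) \<in> parcs G"
        by simp
      with W have "vwalk (p # W) (with_proj G)"
        by (intro vwalk_consI) (auto dest: in_arcsD1)
      with W show ?thesis
        by (intro exI[of _ "p # W"]) auto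
    qed
  qed
  then obtain W where W: "vwalk W (with_proj G)" "hd W = p" "last W = q" "length W \<le> Suc n"
    by blast
  obtain P where "vpath P (with_proj G)" "hd P = p" "last P = q" "length P \<le> card (set W)"
    using vwalk_imp_shorter_vpath[OF W(1)] W(2,3) by metis
  with W(4) card_length[of W] show ?thesis
    by (intro exI[of _ P]) (auto simp: path_between_def)
qed

lemma relpow_reflcl_mono:
  assumes "(x, y) \<in> (R\<^sup>=) ^^ m" "m \<le> n"
  shows "(x, y) \<in> (R\<^sup>=) ^^ n"
  using assms(2,1)
proof (induction n rule: dec_induct)
  case (step n)
  then show ?case
    by (auto intro: relpow_Suc_I)
qed

lemma relpow_sym:
  assumes "sym R"
  shows "sym (R ^^ n)"
proof (induction n)
  case (Suc n)
  show ?case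
  proof (rule symI)
    fix x y assume "(x, y) \<in> R ^^ Suc n"
    then obtain z where "(x, z) \<in> R ^^ n" "(z, y) \<in> R"
      by (rule relpow_Suc_E)
    then have "(y, z) \<in> R" "(z, x) \<in> R ^^ n"
      using assms Suc by (auto dest: symD)
    then show "(y, x) \<in> R ^^ Suc n"
      by (rule relpow_Suc_I2)
  qed
qed (auto intro: symI)

section \<open>Folded index sequences and the arithmetic of the cost\<close>

text \<open>Climbs to \<open>t\<close>, then bounces between \<open>t\<close> and
  \<open>t - 1\<close>; read along a path, this is the folded walk.\<close>

definition fold_index :: "nat \<Rightarrow> nat \<Rightarrow> nat" where
  "fold_index t i = (if i \<le> t then i else if even (i + t) then t else t - 1)"

lemma fold_index_le: "fold_index t i \<le> t"
  by (simp add: fold_index_def)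

lemma fold_index_Suc:
  assumes "1 \<le> t"
  shows "fold_index t (Suc i) = Suc (fold_index t i) \<or> fold_index t i = Suc (fold_index t (Suc i))"
  using assms by (cases "i = t") (auto simp: fold_index_def not_le le_Suc_eq split: if_splits)

text \<open>Supplies the crossing arcs that \<open>merge_exchange\<close> asks for between
  consecutive foldings.\<close>

lemma fold_index_Suc_Suc:
  assumes "1 \<le> t"
  shows "fold_index t (Suc i) = Suc (fold_index (Suc t) i) \<or>
    fold_index (Suc t) i = Suc (fold_index t (Suc i))"
  using assms by (cases "i = t") (auto simp: fold_index_def not_le le_Suc_eq split: if_splits)

lemma fold_index_neqD:
  assumes "fold_index (Suc t) i \<noteq> fold_index t i"
  shows "Suc t \<le> i \<and> even (i - Suc t)"
  using assms by (cases "i = t") (auto simp: fold_index_def not_le le_Suc_eq split: if_splits)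

lemma fold_index_1: "fold_index (Suc 0) i = i mod 2"
  by (cases i) (auto simp: fold_index_def mod2_eq_if)

text \<open>The bound is the ceiling of \<open>(d - t) / 2\<close>, the number of terms of t, t + 2,
  ... below \<open>d\<close>.\<close>

lemma card_every_second_le:
  assumes "\<And>i. i \<in> S \<Longrightarrow> t \<le> i \<and> i < d \<and> even (i - t)"
  shows "card S \<le> (Suc d - t) div 2"
proof -
  have "S \<subseteq> (\<lambda>j. t + 2 * j) ` {..<(Suc d - t) div 2}"
  proof
    fix i assume "i \<in> S"
    then have "i = t + 2 * ((i - t) div 2)" "(i - t) div 2 < (Suc d - t) div 2"
      using assms[of i] by presburger+
    then show "i \<in> (\<lambda>j. t + 2 * j) ` {..<(Suc d - t) div 2}"
      by blast
  qed
  then have "card S \<le> card ((\<lambda>j. t + 2 * j) ` {..<(Suc d - t) div 2})"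
    by (intro card_mono) auto
  also have "\<dots> \<le> (Suc d - t) div 2"
    using card_image_le[of "{..<(Suc d - t) div 2}"] by simp
  finally show ?thesis .
qed

text \<open>Hence \<open>k^2 div 4\<close> is the sum of \<open>j div 2\<close> over j \<le> k, the
  total cost of \<open>k\<close> successive folds.\<close>

lemma Suc_square_div_4: "(Suc k)\<^sup>2 div 4 = k\<^sup>2 div 4 + Suc k div 2"
proof (cases "even k")
  case True
  then obtain m where "k = 2 * m" ..
  then have "(Suc k)\<^sup>2 = 1 + 4 * (m\<^sup>2 + m)" "k\<^sup>2 = 4 * m\<^sup>2" "Suc k div 2 = m"
    by (simp_all add: power2_eq_square algebra_simps)
  then show ?thesis
    by presburger
next
  case False
  then obtain m where "k = 2 * m + 1"
    by (rule oddE)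
  then have "(Suc k)\<^sup>2 = 4 * (m\<^sup>2 + 2 * m + 1)" "k\<^sup>2 = 1 + 4 * (m\<^sup>2 + m)" "Suc k div 2 = m + 1"
    by (simp_all add: power2_eq_square algebra_simps)
  then show ?thesis
    by presburger
qed

lemma reconfiguration_cost_le:
  assumes "2 \<le> d"
  shows "real (2 * ((d - 1)\<^sup>2 div 4) + d div 2) \<le> (real d)\<^sup>2 / 2 - 1"
proof -
  have "real ((d - 1)\<^sup>2 div 4) \<le> real ((d - 1)\<^sup>2) / 4"
    using of_nat_div_le_of_nat[of "(d - 1)\<^sup>2" 4] by simp
  also have "\<dots> = (real d - 1)\<^sup>2 / 4"
    using assms by (simp add: of_nat_diff)
  finally have a: "2 * real ((d - 1)\<^sup>2 div 4) \<le> (real d - 1)\<^sup>2 / 2"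
    by simp
  show ?thesis
  \<comment> \<open>Dropping the floors gives \<open>(d^2 - d + 1) / 2\<close>, which is small
    enough only from d = 3 on. At d = 2 the bound is attained, and the floor
    \<open>1 div 4 = 0\<close> is essential.\<close>
  proof (cases "d = 2")
    case False
    have "real (2 * (d div 2)) \<le> real d"
      by (intro of_nat_mono) simp
    with a False assms show ?thesis
      by (simp add: power2_eq_square field_simps)
  qed simp
qed

section \<open>Merging walks with the majority homomorphism\<close>

locale majority_spr = pair_sym_digraph H for H :: "'a pair_pre_digraph" +
  fixes f :: "'a \<times> 'a \<times> 'a \<Rightarrow> 'a" and u v :: 'a and d :: nat and \<phi> \<psi> :: "'a vwalk"
  assumes hom: "graph_hom f (cube H) H"
    and majority: "\<And>x y. x \<in> pverts H \<Longrightarrow> y \<in> pverts H \<Longrightarrow>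
      f (x, x, y) = x \<and> f (x, y, x) = x \<and> f (y, x, x) = x"
    and dist: "graph_dist H u v = enat d"
    and shortest: "shortest_path H u v \<phi>" "shortest_path H u v \<psi>"
begin

lemma arcs_sym: "(x, y) \<in> parcs H \<Longrightarrow> (y, x) \<in> parcs H"
  using pair_sym_arcs by (simp add: symmetric_def sym_def)

lemma shortest_pathD:
  assumes "shortest_path H u v p"
  shows "length p = Suc d" "p ! 0 = u" "p ! d = v"
    and "\<And>i. i \<le> d \<Longrightarrow> p ! i \<in> pverts H"
    and "\<And>i. i < d \<Longrightarrow> (p ! i, p ! Suc i) \<in> parcs H"
proof -
  have w: "vwalk p (with_proj H)" "hd p = u" "last p = v" and l: "vwalk_length p = d"
    using assms dist by (auto simp: shortest_path_def path_between_def)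
  then have "p \<noteq> []"
    by auto
  with l show length: "length p = Suc d"
    by (cases p) auto
  show "p ! 0 = u" "p ! d = v"
    using w \<open>p \<noteq> []\<close> length by (simp_all add: hd_conv_nth last_conv_nth)
  show "p ! i \<in> pverts H" if "i \<le> d" for i
    using w length that by (auto simp: vwalk_conv_nth)
  show "(p ! i, p ! Suc i) \<in> parcs H" if "i < d" for i
    using w length that by (auto simp: vwalk_conv_nth)
qed

text \<open>Infinite sequences avoid boundary cases at the right end; \<open>merge\<close> reads
  only the positions up to \<open>d\<close>.\<close>

definition walk :: "(nat \<Rightarrow> 'a) \<Rightarrow> bool" where
  "walk w \<longleftrightarrow> (\<forall>i. (w i, w (Suc i)) \<in> parcs H)"

lemma walk_in_verts: "walk w \<Longrightarrow> w i \<in> pverts H"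
  unfolding walk_def by (blast dest: in_arcsD1)

definition merge :: "(nat \<Rightarrow> 'a) \<Rightarrow> 'a vwalk" where
  "merge w = map (\<lambda>i. f (\<phi> ! i, \<psi> ! i, w i)) [0..<Suc d]"

lemma length_merge [simp]: "length (merge w) = Suc d"
  by (simp add: merge_def)

lemma nth_merge [simp]: "i \<le> d \<Longrightarrow> merge w ! i = f (\<phi> ! i, \<psi> ! i, w i)"
  unfolding merge_def by (subst nth_map) (auto simp del: upt_Suc)

text \<open>Both paths agree at positions 0 and \<open>d\<close>, so the majority overrules
  \<open>w\<close> there.\<close>

lemma merge_ends:
  assumes "walk w"
  shows "merge w ! 0 = u" "merge w ! d = v"
  using majority walk_in_verts[OF assms] shortest_pathD(2-4)[OF shortest(1)]
    shortest_pathD(2-4)[OF shortest(2)]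
  by (metis le0 nth_merge, metis order_refl nth_merge)

text \<open>The three walks form one walk in the cube, and \<open>f\<close> maps it to a walk from
  \<open>u\<close> to \<open>v\<close> whose length is the distance.\<close>

lemma shortest_path_merge:
  assumes "walk w"
  shows "shortest_path H u v (merge w)"
proof (rule vwalk_of_length_dist_imp_shortest_path)
  have ne: "merge w \<noteq> []"
    by (metis length_merge list.size(3) nat.distinct(1))
  show "hd (merge w) = u" "last (merge w) = v"
    using merge_ends[OF assms] ne by (simp_all add: hd_conv_nth last_conv_nth del: nth_merge)
  show "enat (vwalk_length (merge w)) = graph_dist H u v"
    by (simp add: dist)
  have "set (merge w) \<subseteq> pverts H"
  proof
    fix x assume "x \<in> set (merge w)"
    then obtain i where i: "i \<le> d" "x = f (\<phi> ! i, \<psi> ! i, w i)"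
      by (auto simp: in_set_conv_nth less_Suc_eq_le)
    then have "(\<phi> ! i, \<psi> ! i, w i) \<in> pverts (cube H)"
      using shortest_pathD(4) shortest walk_in_verts[OF assms] by (simp add: cube_def)
    with i show "x \<in> pverts H"
      using hom by (simp add: graph_hom_def)
  qed
  moreover have "(merge w ! i, merge w ! Suc i) \<in> parcs H" if "Suc i < length (merge w)" for i
  proof -
    have "((\<phi> ! i, \<psi> ! i, w i), (\<phi> ! Suc i, \<psi> ! Suc i, w (Suc i))) \<in> parcs (cube H)"
      using shortest_pathD(5) shortest assms that by (simp add: cube_def walk_def)
    with that show ?thesis
      using hom by (simp add: graph_hom_def)
  qed
  ultimately show "vwalk (merge w) (with_proj H)"
    using ne by (simp add: vwalk_conv_nth)
qed

text \<open>Reflexive, since changing one vertex of \<open>w\<close> may leave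
  \<open>merge w\<close> as it is.\<close>

abbreviation step :: "('a vwalk \<times> 'a vwalk) set" where
  "step \<equiv> (parcs (SP H u v))\<^sup>="

lemma sym_step: "sym step"
proof -
  interpret SP: pair_bidirected_digraph "SP H u v"
    by (rule pair_bidirected_digraph_SP)
  show ?thesis
    using SP.pair_sym_arcs by (auto simp: symmetric_def sym_def)
qed

lemma merge_step:
  assumes "walk w" "walk w'" "\<And>i. i \<noteq> k \<Longrightarrow> w i = w' i"
  shows "(merge w, merge w') \<in> step"
proof (cases "merge w = merge w'")
  case False
  then obtain j where j: "j \<le> d" "merge w ! j \<noteq> merge w' ! j"
    by (auto simp: list_eq_iff_nth_eq less_Suc_eq_le simp del: nth_merge)
  then have "j = k"
    using assms(3)[of j] by (cases "j = k") auto
  have "\<exists>!i. i < length (merge w) \<and> merge w ! i \<noteq> merge w' ! i"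
  proof (rule ex1I[of _ k])
    show "k < length (merge w) \<and> merge w ! k \<noteq> merge w' ! k"
      using j \<open>j = k\<close> by simp
    show "i = k" if "i < length (merge w) \<and> merge w ! i \<noteq> merge w' ! i" for i
      using that assms(3)[of i] by (cases "i = k") (auto simp: less_Suc_eq_le)
  qed
  then show ?thesis
    using shortest_path_merge assms(1,2) by (simp add: SP_def)
qed simp

text \<open>
  The walks are exchanged from left to right; the crossing arcs make every intermediate sequence
  a walk.
\<close>

lemma merge_exchange:
  assumes w: "walk w" "walk w'" and cross: "\<And>i. (w' i, w (Suc i)) \<in> parcs H"
    and card: "card {i. 0 < i \<and> i < d \<and> w i \<noteq> w' i} \<le> n"
  shows "(merge w, merge w') \<in> step ^^ n"
proof -
  define x where "x k i = (if i < k then w' i else w i)" for k i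
  define D where "D k = {i. 0 < i \<and> i < d \<and> w i \<noteq> w' i \<and> i < k}" for k
  have walk_x: "walk (x k)" for k
    unfolding walk_def
  proof
    fix i
    \<comment> \<open>Only the seam, where a new vertex is followed by an old one, uses a crossing
      arc.\<close>
    consider "Suc i < k" | "Suc i = k" | "k \<le> i"
      by linarith
    then show "(x k i, x k (Suc i)) \<in> parcs H"
      using w cross[of i] by cases (auto simp: x_def walk_def)
  qed
  have "(merge w, merge (x k)) \<in> step ^^ card (D k)" for k
  proof (induction k)
    case 0
    then show ?case
      by (simp add: D_def x_def)
  next
    case (Suc k)
    have fin: "finite (D k)"
      by (rule finite_subset[of _ "{..<k}"]) (auto simp: D_def)
    show ?case
    proof (cases "k \<in> D (Suc k)")
      case True
      then have "D (Suc k) = insert k (D k)" "k \<notin> D k"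
        by (auto simp: D_def)
      then have "card (D (Suc k)) = Suc (card (D k))"
        using fin by simp
      moreover have "(merge (x k), merge (x (Suc k))) \<in> step"
        by (rule merge_step[OF walk_x walk_x, of k]) (auto simp: x_def)
      ultimately show ?thesis
        using relpow_Suc_I[OF Suc] by simp
    next
      case False
      then have "D (Suc k) = D k"
        by (auto simp: D_def less_Suc_eq)
      \<comment> \<open>Changes at position 0 or \<open>d\<close> are overruled by the majority, and
        those beyond \<open>d\<close> are never read, so they cost nothing.\<close>
      moreover have "merge (x (Suc k)) = merge (x k)"
      proof (rule nth_equalityI)
        fix i assume "i < length (merge (x (Suc k)))"
        then have "i \<le> d"
          by simp
        have "k = 0 \<or> d \<le> k \<or> w k = w' k"
          using False by (auto simp: D_def)
        then consider "i = 0" | "i = d" | "x (Suc k) i = x k i"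
          using \<open>i \<le> d\<close> by (cases "i = k") (auto simp: x_def)
        then show "merge (x (Suc k)) ! i = merge (x k) ! i"
          using merge_ends[OF walk_x] \<open>i \<le> d\<close> by cases (metis, metis, simp)
      qed simp
      ultimately show ?thesis
        using Suc by simp
    qed
  qed
  \<comment> \<open>At \<open>Suc d\<close> every position that \<open>merge\<close> reads has been
    exchanged.\<close>
  from this[of "Suc d"] have "(merge w, merge (x (Suc d))) \<in> step ^^ card (D (Suc d))" .
  moreover have "merge (x (Suc d)) = merge w'"
    by (rule nth_equalityI) (auto simp: x_def)
  moreover have "D (Suc d) = {i. 0 < i \<and> i < d \<and> w i \<noteq> w' i}"
    by (auto simp: D_def)
  ultimately show ?thesis
    using card relpow_reflcl_mono by metis
qed

section \<open>Folding the paths and joining their first edges\<close>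

lemma fold_arc:
  assumes "shortest_path H u v p" "t \<le> d" "t' \<le> d"
    and "fold_index t i = Suc (fold_index t' j) \<or> fold_index t' j = Suc (fold_index t i)"
  shows "(p ! fold_index t i, p ! fold_index t' j) \<in> parcs H"
  using assms(4)
proof
  assume "fold_index t i = Suc (fold_index t' j)"
  moreover have "fold_index t i \<le> d"
    using fold_index_le assms(2) by (rule order_trans)
  ultimately show ?thesis
    using shortest_pathD(5)[OF assms(1), of "fold_index t' j"] arcs_sym by simp
next
  assume "fold_index t' j = Suc (fold_index t i)"
  moreover have "fold_index t' j \<le> d"
    using fold_index_le assms(3) by (rule order_trans)
  ultimately show ?thesis
    using shortest_pathD(5)[OF assms(1), of "fold_index t i"] by simp
qed

lemma walk_fold:
  assumes "shortest_path H u v p" "1 \<le> t" "t \<le> d"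
  shows "walk (\<lambda>i. p ! fold_index t i)"
  unfolding walk_def using fold_arc[OF assms(1,3,3)] fold_index_Suc[OF assms(2)] by blast

lemma merge_fold_step:
  assumes p: "shortest_path H u v p" and t: "1 \<le> t" "Suc t \<le> d"
  shows "(merge (\<lambda>i. p ! fold_index (Suc t) i), merge (\<lambda>i. p ! fold_index t i))
    \<in> step ^^ ((d - t) div 2)"
proof -
  let ?w = "\<lambda>t i. p ! fold_index t i"
  \<comment> \<open>The exchange is run as an unfolding, from \<open>t\<close> to
    \<open>Suc t\<close>, and reversed by symmetry of \<open>step\<close>.\<close>
  have "(merge (?w t), merge (?w (Suc t))) \<in> step ^^ ((d - t) div 2)"
  proof (rule merge_exchange)
    show "walk (?w (Suc t))" "walk (?w t)"
      using walk_fold p t by simp_all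
    show "(?w (Suc t) i, ?w t (Suc i)) \<in> parcs H" for i
      using fold_index_Suc_Suc[OF t(1), of i] t by (intro fold_arc[OF p]) auto
    have "Suc t \<le> i \<and> even (i - Suc t)" if "?w t i \<noteq> ?w (Suc t) i" for i
      using that by (intro fold_index_neqD) auto
    then have "card {i. 0 < i \<and> i < d \<and> ?w t i \<noteq> ?w (Suc t) i} \<le> (Suc d - Suc t) div 2"
      by (intro card_every_second_le) blast
    then show "card {i. 0 < i \<and> i < d \<and> ?w t i \<noteq> ?w (Suc t) i} \<le> (d - t) div 2"
      by simp
  qed
  then show ?thesis
    using relpow_sym[OF sym_step] by (blast dest: symD)
qed

lemma merge_fold:
  assumes p: "shortest_path H u v p" and "1 \<le> d"
  shows "(merge ((!) p), merge (\<lambda>i. p ! (i mod 2))) \<in> step ^^ ((d - 1)\<^sup>2 div 4)"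
proof -
  \<comment> \<open>\<open>k\<close> is the number of folds done; \<open>k < d\<close> keeps the
    fold position at least 1.\<close>
  have "(merge (\<lambda>i. p ! fold_index d i), merge (\<lambda>i. p ! fold_index (d - k) i))
      \<in> step ^^ (k\<^sup>2 div 4)" if "k < d" for k
    using that
  proof (induction k)
    case (Suc k)
    then have "d - k = Suc (d - Suc k)"
      by simp
    then have "(merge (\<lambda>i. p ! fold_index (d - k) i), merge (\<lambda>i. p ! fold_index (d - Suc k) i))
      \<in> step ^^ (Suc k div 2)"
      using merge_fold_step[OF p, of "d - Suc k"] Suc.prems by simp
    with Suc show ?case
      by (auto simp: Suc_square_div_4 relpow_add)
  qed simp
  \<comment> \<open>After \<open>d - 1\<close> folds the walk bounces on the first edge
    alone.\<close>
  from this[of "d - 1"] \<open>1 \<le> d\<close>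
  have "(merge (\<lambda>i. p ! fold_index d i), merge (\<lambda>i. p ! (i mod 2))) \<in> step ^^ ((d - 1)\<^sup>2 div 4)"
    using fold_index_1 by simp
  moreover have "merge (\<lambda>i. p ! fold_index d i) = merge ((!) p)"
    by (rule nth_equalityI) (auto simp: fold_index_def)
  ultimately show ?thesis
    by simp
qed

text \<open>Both walks are at \<open>u\<close> at even times. So every crossing arc joins
  \<open>u\<close> to a neighbour on one of the paths, and only odd positions change.\<close>

lemma merge_first_edges:
  assumes "1 \<le> d"
  shows "(merge (\<lambda>i. \<phi> ! (i mod 2)), merge (\<lambda>i. \<psi> ! (i mod 2))) \<in> step ^^ (d div 2)"
proof (rule merge_exchange)
  have start: "\<phi> ! 0 = u" "\<psi> ! 0 = u" "(u, \<phi> ! Suc 0) \<in> parcs H" "(u, \<psi> ! Suc 0) \<in> parcs H"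
    using shortest_pathD(2,5) shortest assms by (metis Suc_le_eq One_nat_def)+
  show "walk (\<lambda>i. \<phi> ! (i mod 2))" "walk (\<lambda>i. \<psi> ! (i mod 2))"
    using walk_fold[of _ "Suc 0"] shortest assms by (simp_all add: fold_index_1)
  show "(\<psi> ! (i mod 2), \<phi> ! (Suc i mod 2)) \<in> parcs H" for i
    using start arcs_sym by (cases "even i") (auto simp: mod2_eq_if)
  have "1 \<le> i \<and> even (i - 1)" if "\<phi> ! (i mod 2) \<noteq> \<psi> ! (i mod 2)" for i
  proof -
    have "odd i"
    proof
      assume "even i"
      then have "i mod 2 = 0"
        by simp
      with that show False
        using start(1,2) by metis
    qed
    then show ?thesis
      by (cases i) auto
  qed
  then have "card {i. 0 < i \<and> i < d \<and> \<phi> ! (i mod 2) \<noteq> \<psi> ! (i mod 2)} \<le> (Suc d - 1) div 2"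
    by (intro card_every_second_le) blast
  then show "card {i. 0 < i \<and> i < d \<and> \<phi> ! (i mod 2) \<noteq> \<psi> ! (i mod 2)} \<le> d div 2"
    by simp
qed

text \<open>The third argument repeats one of the first two, so it wins the majority.\<close>

lemma merge_self: "merge ((!) \<phi>) = \<phi>" "merge ((!) \<psi>) = \<psi>"
  using shortest_pathD(1,4)[OF shortest(1)] shortest_pathD(1,4)[OF shortest(2)] majority
  by (auto intro!: nth_equalityI simp: less_Suc_eq_le)

lemma reconfiguration:
  assumes "1 \<le> d"
  shows "(\<phi>, \<psi>) \<in> step ^^ (2 * ((d - 1)\<^sup>2 div 4) + d div 2)"
proof -
  let ?c = "(d - 1)\<^sup>2 div 4"
  let ?e\<phi> = "merge (\<lambda>i. \<phi> ! (i mod 2))" and ?e\<psi> = "merge (\<lambda>i. \<psi> ! (i mod 2))"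
  have "(\<phi>, ?e\<phi>) \<in> step ^^ ?c" "(\<psi>, ?e\<psi>) \<in> step ^^ ?c"
    using merge_fold shortest assms merge_self by metis+
  moreover from this(2) have "(?e\<psi>, \<psi>) \<in> step ^^ ?c"
    using relpow_sym[OF sym_step] by (blast dest: symD)
  ultimately have "(\<phi>, \<psi>) \<in> step ^^ (?c + (d div 2 + ?c))"
    using merge_first_edges[OF assms] unfolding relpow_add by blast
  moreover have "?c + (d div 2 + ?c) = 2 * ?c + d div 2"
    by simp
  ultimately show ?thesis
    by metis
qed

text \<open>Such paths have no interior vertex. This is the range where d^2/2 - 1 is negative and
  the bound is 0.\<close>

lemma eq_if_dist_le_1:
  assumes "d \<le> 1"
  shows "\<phi> = \<psi>"
proof (rule nth_equalityI)
  show "length \<phi> = length \<psi>"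
    using shortest_pathD(1) shortest by simp
  fix i assume "i < length \<phi>"
  then have "i = 0 \<or> i = d"
    using assms shortest_pathD(1)[OF shortest(1)] by auto
  then show "\<phi> ! i = \<psi> ! i"
    using shortest_pathD(2,3) shortest by metis
qed

end

theorem corollary5p3:
  fixes H :: "'a pair_pre_digraph" and u v :: 'a and \<phi> \<psi> :: "'a vwalk" and d :: nat
  assumes "nu3_graph H"
    and "spr_d_instance d H u v \<phi> \<psi>"
  shows "\<exists>P. path_between (SP H u v) \<phi> \<psi> P \<and>
    real (vwalk_length P) \<le> max 0 ((real d)\<^sup>2 / 2 - 1)"
proof -
  interpret H: pair_sym_digraph H
    using assms(1) by (simp add: nu3_graph_def)
  obtain f where "graph_hom f (cube H) H" and "\<And>x y. x \<in> pverts H \<Longrightarrow> y \<in> pverts H \<Longrightarrow>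
      f (x, x, y) = x \<and> f (x, y, x) = x \<and> f (y, x, x) = x"
    using assms(1) unfolding nu3_graph_def by blast
  then interpret majority_spr H f u v d \<phi> \<psi>
    using assms(2) by unfold_locales (auto simp: spr_d_instance_def spr_instance_def)
  interpret SP: pair_bidirected_digraph "SP H u v"
    by (rule pair_bidirected_digraph_SP)
  obtain n where n: "(\<phi>, \<psi>) \<in> step ^^ n" "real n \<le> max 0 ((real d)\<^sup>2 / 2 - 1)"
  proof (cases "d \<le> 1")
    case True
    then show thesis
      using that[of 0] eq_if_dist_le_1 by simp
  next
    case False
    then show thesis
      using that reconfiguration reconfiguration_cost_le[of d] by (force simp: max.coboundedI2)
  qed
  have "\<psi> \<in> pverts (SP H u v)"
    using shortest(2) by (simp add: SP_def)
  then obtain P where "path_between (SP H u v) \<phi> \<psi> P" "vwalk_length P \<le> n"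
    using relpow_reflcl_imp_path_between[OF n(1)] SP.pair_wf_digraph_axioms by blast
  then show ?thesis
    using n(2) by (meson of_nat_mono order_trans)
qed

end
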